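(* Let $n_1,n_2,n_3\ge 0$ be integers. The kernel $K_{n_3,n_2,n_1}$ of the composition $M_{n_3}\circ M_{n_2}\circ M_{n_1}$ of classical Bernstein--Durrmeyer operators has, for $x,y\in[0,1]$, the representation $$K_{n_3,n_2,n_1}(x,y)=\frac{(n_3+1)!\,(n_2+1)!\,(n_1+1)!\,(n_3+n_2+n_1+1)!}{(n_3+n_2+1)!\,(n_3+n_1+1)!\,(n_2+n_1+1)!}\sum_{k=0}^{\min\{n_1,n_2,n_3\}}\frac{\binom{n_3}{k}\binom{n_2}{k}\binom{n_1}{k}}{\binom{n_3+n_2+n_1+1}{k}}\sum_{\ell=0}^{k}p_{k,\ell}(x)\,p_{k,\ell}(y).$$
   Context: For integers $n\ge 0$ and $0\le k\le n$, let $p_{n,k}(x)=\binom{n}{k}x^k(1-x)^{n-k}$. The Bernstein--Durrmeyer operator $M_n$ maps $f\in L_1[0,1]$ to the polynomial $$(M_nf)(x)=\int_0^1 f(y)K_n(x,y)\,dy,\quad x\in[0,1],\qquad K_n(x,y)=(n+1)\sum_{k=0}^n p_{n,k}(x)p_{n,k}(y).$$ The kernels of the compositions are defined recursively by $$K_{n_2,n_1}(x,y)=\int_0^1 K_{n_1}(t,y)\,K_{n_2}(x,t)\,dt,\qquad K_{n_3,n_2,n_1}(x,y)=\int_0^1 K_{n_2,n_1}(t,y)\,K_{n_3}(x,t)\,dt,$$ so that $((M_{n_3}\circ M_{n_2}\circ M_{n_1})f)(x)=\int_0^1 f(y)K_{n_3,n_2,n_1}(x,y)\,dy$ for $f\in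 L_1[0,1]$. *)

theory Defs
  imports "HOL-Analysis.Analysis"
begin

text \<open>
  The basis polynomials \<open>p\<^sub>n\<^sub>,\<^sub>k\<close> are \<^term>\<open>Bernstein n k\<close> from the library. Integrals are Lebesgue
  integrals over \<open>[0, 1]\<close>, and \<open>f \<in> L\<^sub>1[0, 1]\<close> is \<^term>\<open>set_integrable lebesgue {0..1} f\<close>.
\<close>

definition durrmeyer_kernel :: "nat \<Rightarrow> real \<Rightarrow> real \<Rightarrow> real" where
  "durrmeyer_kernel n x y = (real n + 1) * (\<Sum>k\<le>n. Bernstein n k x * Bernstein n k y)"

definition durrmeyer_op :: "nat \<Rightarrow> (real \<Rightarrow> real) \<Rightarrow> real \<Rightarrow> real" where
  "durrmeyer_op n f x = (LINT y:{0..1}|lebesgue. f y * durrmeyer_kernel n x y)"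

definition durrmeyer_kernel2 :: "nat \<Rightarrow> nat \<Rightarrow> real \<Rightarrow> real \<Rightarrow> real" where
  "durrmeyer_kernel2 n2 n1 x y =
     (LINT t:{0..1}|lebesgue. durrmeyer_kernel n1 t y * durrmeyer_kernel n2 x t)"

definition durrmeyer_kernel3 :: "nat \<Rightarrow> nat \<Rightarrow> nat \<Rightarrow> real \<Rightarrow> real \<Rightarrow> real" where
  "durrmeyer_kernel3 n3 n2 n1 x y =
     (LINT t:{0..1}|lebesgue. durrmeyer_kernel2 n2 n1 t y * durrmeyer_kernel n3 x t)"

text \<open>The kernels so defined are indeed the kernels of the composed operators.\<close>

lemma continuous_on_Bernstein [continuous_intros]: "continuous_on S (Bernstein n k)"
  unfolding Bernstein_def by (intro continuous_intros)

lemma continuous_on_durrmeyer_kernel: "continuous_on S (durrmeyer_kernel n x)"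
  unfolding durrmeyer_kernel_def by (intro continuous_intros)

lemma set_integrable_mult_continuous:
  fixes f g :: "real \<Rightarrow> real"
  assumes f: "set_integrable lebesgue {0..1} f" and g: "continuous_on {0..1} g"
  shows "set_integrable lebesgue {0..1} (\<lambda>y. f y * g y)"
proof -
  have "(\<lambda>y. g y * f y) absolutely_integrable_on {0..1}"
    using g f
    by (intro absolutely_integrable_bounded_measurable_product_real
          continuous_imp_measurable_on_sets_lebesgue compact_imp_bounded
          compact_continuous_image) auto
  then show ?thesis by (simp add: mult.commute)
qed

lemma set_integrable_continuous:
  fixes g :: "real \<Rightarrow> real"
  assumes "continuous_on {0..1} g"
  shows "set_integrable lebesgue {0..1} g"
  using absolutely_integrable_continuous_real[OF assms] .

lemma set_lebesgue_integral_sum: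
  fixes g :: "'i \<Rightarrow> 'a \<Rightarrow> real"
  assumes "\<And>i. i \<in> I \<Longrightarrow> set_integrable M A (g i)"
  shows "(LINT x:A|M. (\<Sum>i\<in>I. g i x)) = (\<Sum>i\<in>I. LINT x:A|M. g i x)"
  unfolding set_lebesgue_integral_def scaleR_sum_right
  by (rule Bochner_Integration.integral_sum) (use assms in \<open>simp add: set_integrable_def\<close>)

lemma integral_swap_separable:
  fixes f k :: "real \<Rightarrow> real" and a b :: "'i \<Rightarrow> real \<Rightarrow> real"
  assumes f: "set_integrable lebesgue {0..1} f"
    and a: "\<And>i. i \<in> I \<Longrightarrow> continuous_on {0..1} (a i)"
    and b: "\<And>i. i \<in> I \<Longrightarrow> continuous_on {0..1} (b i)"
    and k: "continuous_on {0..1} k"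
  shows "(LINT t:{0..1}|lebesgue. (LINT y:{0..1}|lebesgue. f y * (\<Sum>i\<in>I. a i t * b i y)) * k t)
       = (LINT y:{0..1}|lebesgue. f y * (LINT t:{0..1}|lebesgue. (\<Sum>i\<in>I. a i t * b i y) * k t))"
proof -
  have fb: "set_integrable lebesgue {0..1} (\<lambda>y. f y * b i y)" if "i \<in> I" for i
    using set_integrable_mult_continuous[OF f b[OF that]] .
  have ak: "set_integrable lebesgue {0..1} (\<lambda>t. a i t * k t)" if "i \<in> I" for i
    using a[OF that] k by (intro set_integrable_continuous continuous_intros)
  let ?F = "\<lambda>i. LINT y:{0..1}|lebesgue. f y * b i y"
  let ?A = "\<lambda>i. LINT t:{0..1}|lebesgue. a i t * k t"
  have "(LINT y:{0..1}|lebesgue. f y * (\<Sum>i\<in>I. a i t * b i y)) = (\<Sum>i\<in>I. a i t * ?F i)" for t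
  proof -
    have "(LINT y:{0..1}|lebesgue. f y * (\<Sum>i\<in>I. a i t * b i y))
        = (LINT y:{0..1}|lebesgue. (\<Sum>i\<in>I. a i t * (f y * b i y)))"
      by (simp add: sum_distrib_left mult_ac)
    also have "\<dots> = (\<Sum>i\<in>I. LINT y:{0..1}|lebesgue. a i t * (f y * b i y))"
      using fb by (intro set_lebesgue_integral_sum set_integrable_mult_right) auto
    finally show ?thesis by simp
  qed
  then have "(LINT t:{0..1}|lebesgue. (LINT y:{0..1}|lebesgue. f y * (\<Sum>i\<in>I. a i t * b i y)) * k t)
      = (LINT t:{0..1}|lebesgue. (\<Sum>i\<in>I. ?F i * (a i t * k t)))"
    by (simp add: sum_distrib_right sum_distrib_left mult_ac)
  also have "\<dots> = (\<Sum>i\<in>I. LINT t:{0..1}|lebesgue. ?F i * (a i t * k t))"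
    using ak by (intro set_lebesgue_integral_sum set_integrable_mult_right) auto
  also have "\<dots> = (\<Sum>i\<in>I. ?F i * ?A i)" by simp
  finally have L: "(LINT t:{0..1}|lebesgue. (LINT y:{0..1}|lebesgue. f y * (\<Sum>i\<in>I. a i t * b i y)) * k t)
      = (\<Sum>i\<in>I. ?F i * ?A i)" .
  have "(LINT t:{0..1}|lebesgue. (\<Sum>i\<in>I. a i t * b i y) * k t) = (\<Sum>i\<in>I. b i y * ?A i)" for y
  proof -
    have "(LINT t:{0..1}|lebesgue. (\<Sum>i\<in>I. a i t * b i y) * k t)
        = (LINT t:{0..1}|lebesgue. (\<Sum>i\<in>I. b i y * (a i t * k t)))"
      by (simp add: sum_distrib_right sum_distrib_left mult_ac)
    also have "\<dots> = (\<Sum>i\<in>I. LINT t:{0..1}|lebesgue. b i y * (a i t * k t))"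
      using ak by (intro set_lebesgue_integral_sum set_integrable_mult_right) auto
    finally show ?thesis by simp
  qed
  then have "(LINT y:{0..1}|lebesgue. f y * (LINT t:{0..1}|lebesgue. (\<Sum>i\<in>I. a i t * b i y) * k t))
      = (LINT y:{0..1}|lebesgue. (\<Sum>i\<in>I. ?A i * (f y * b i y)))"
    by (simp add: sum_distrib_left mult_ac)
  also have "\<dots> = (\<Sum>i\<in>I. LINT y:{0..1}|lebesgue. ?A i * (f y * b i y))"
    using fb by (intro set_lebesgue_integral_sum set_integrable_mult_right) auto
  also have "\<dots> = (\<Sum>i\<in>I. ?F i * ?A i)" by (simp add: mult.commute)
  finally show ?thesis using L by simp
qed

lemma durrmeyer_kernel_separable:
  "durrmeyer_kernel n t y = (\<Sum>i\<le>n. ((real n + 1) * Bernstein n i t) * Bernstein n i y)"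
  by (simp add: durrmeyer_kernel_def sum_distrib_left mult_ac)

lemma durrmeyer_op_comp2:
  assumes "set_integrable lebesgue {0..1} f"
  shows "durrmeyer_op n2 (durrmeyer_op n1 f) x
       = (LINT y:{0..1}|lebesgue. f y * durrmeyer_kernel2 n2 n1 x y)"
  unfolding durrmeyer_op_def durrmeyer_kernel2_def durrmeyer_kernel_separable[of n1]
  using assms by (intro integral_swap_separable continuous_intros continuous_on_durrmeyer_kernel) auto

lemma durrmeyer_op_continuous:
  assumes "set_integrable lebesgue {0..1} f"
  shows "continuous_on S (durrmeyer_op n f)"
proof -
  have "durrmeyer_op n f x
      = (\<Sum>i\<le>n. ((real n + 1) * Bernstein n i x) * (LINT y:{0..1}|lebesgue. f y * Bernstein n i y))" for x
  proof -
    have "durrmeyer_op n f x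
        = (LINT y:{0..1}|lebesgue. \<Sum>i\<le>n. ((real n + 1) * Bernstein n i x) * (f y * Bernstein n i y))"
      unfolding durrmeyer_op_def durrmeyer_kernel_separable by (simp add: sum_distrib_left mult_ac)
    also have "\<dots> = (\<Sum>i\<le>n. LINT y:{0..1}|lebesgue. ((real n + 1) * Bernstein n i x) * (f y * Bernstein n i y))"
      by (intro set_lebesgue_integral_sum set_integrable_mult_right set_integrable_mult_continuous assms
            continuous_intros)
    finally show ?thesis by simp
  qed
  then have "durrmeyer_op n f = (\<lambda>x. \<Sum>i\<le>n. ((real n + 1) * Bernstein n i x)
      * (LINT y:{0..1}|lebesgue. f y * Bernstein n i y))" by blast
  then show ?thesis by (simp only:) (intro continuous_intros)
qed

lemma durrmeyer_kernel2_separable: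
  "durrmeyer_kernel2 n2 n1 t y
     = (\<Sum>i\<le>n1. ((real n1 + 1) * durrmeyer_op n2 (Bernstein n1 i) t) * Bernstein n1 i y)"
proof -
  have "durrmeyer_kernel2 n2 n1 t y = (LINT s:{0..1}|lebesgue.
      \<Sum>i\<le>n1. ((real n1 + 1) * Bernstein n1 i y) * (Bernstein n1 i s * durrmeyer_kernel n2 t s))"
    unfolding durrmeyer_kernel2_def durrmeyer_kernel_separable[of n1]
    by (simp add: sum_distrib_right sum_distrib_left mult_ac)
  also have "\<dots> = (\<Sum>i\<le>n1. LINT s:{0..1}|lebesgue.
      ((real n1 + 1) * Bernstein n1 i y) * (Bernstein n1 i s * durrmeyer_kernel n2 t s))"
    by (intro set_lebesgue_integral_sum set_integrable_mult_right set_integrable_continuous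
          continuous_intros continuous_on_durrmeyer_kernel)
  also have "\<dots> = (\<Sum>i\<le>n1. ((real n1 + 1) * Bernstein n1 i y) * durrmeyer_op n2 (Bernstein n1 i) t)"
    by (simp add: durrmeyer_op_def)
  finally show ?thesis by (simp add: mult_ac)
qed

lemma durrmeyer_op_comp3:
  assumes "set_integrable lebesgue {0..1} f"
  shows "(durrmeyer_op n3 \<circ> durrmeyer_op n2 \<circ> durrmeyer_op n1) f x
       = (LINT y:{0..1}|lebesgue. f y * durrmeyer_kernel3 n3 n2 n1 x y)"
proof -
  have "durrmeyer_op n2 (durrmeyer_op n1 f)
      = (\<lambda>t. LINT y:{0..1}|lebesgue. f y * durrmeyer_kernel2 n2 n1 t y)"
    using durrmeyer_op_comp2[OF assms] by blast
  then have "(durrmeyer_op n3 \<circ> durrmeyer_op n2 \<circ> durrmeyer_op n1) f x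
      = (LINT t:{0..1}|lebesgue. (LINT y:{0..1}|lebesgue. f y * durrmeyer_kernel2 n2 n1 t y)
          * durrmeyer_kernel n3 x t)"
    by (simp add: durrmeyer_op_def)
  also have "\<dots> = (LINT y:{0..1}|lebesgue. f y * durrmeyer_kernel3 n3 n2 n1 x y)"
    unfolding durrmeyer_kernel3_def durrmeyer_kernel2_separable
    using assms
    by (intro integral_swap_separable continuous_intros durrmeyer_op_continuous
          continuous_on_durrmeyer_kernel)
       (auto intro: set_integrable_continuous continuous_on_Bernstein)
  finally show ?thesis .
qed

end

theory Submission
  imports Defs
begin

text \<open>
  The diagonal kernels \<open>S\<^sub>k(x, y) = (\<Sum>l\<le>k. p\<^sub>k\<^sub>,\<^sub>l(x) p\<^sub>k\<^sub>,\<^sub>l(y))\<close> span a space that is closed under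
  composition of kernels, with explicit structure constants
  (\<open>bernstein_kernel_composition\<close>):
  the composition of \<open>S\<^sub>m\<close> with \<open>S\<^sub>n\<close> is \<open>m! n! / (m + n + 1)!\<close> times the sum of
  \<open>(m choose k) (n choose k) S\<^sub>k\<close> over \<open>k\<close>.
  Since \<open>K\<^sub>n = (n + 1) S\<^sub>n\<close>, applying this rule once gives \<open>K\<^bsub>n2,n1\<^esub>\<close>, and applying it to each
  term of \<open>K\<^bsub>n2,n1\<^esub>\<close> gives \<open>K\<^bsub>n3,n2,n1\<^esub>\<close> as a combination of the \<open>S\<^sub>j\<close>. The coefficient of \<open>S\<^sub>j\<close>
  is then a single sum over the intermediate degree \<open>k\<close>, which the Vandermonde convolution
  evaluates in closed form (\<open>sum_choose_choose_fact\<close>).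

  The composition rule itself comes from comparing coefficients in the products
  \<open>p\<^sub>m\<^sub>,\<^sub>i(x) p\<^sub>n\<^sub>,\<^sub>j(y)\<close>. On the integral side the coefficient is a Beta integral, proportional to
  \<open>(i + j choose i) (m - i + n - j choose m - i)\<close>. On the other side each \<open>S\<^sub>k\<close> is raised to
  degree \<open>m\<close> in \<open>x\<close> and to degree \<open>n\<close> in \<open>y\<close>; the resulting double sum of products of four
  binomial coefficients factors into two Vandermonde sums with exactly these values.
\<close>

section \<open>Degree elevation of Bernstein polynomials\<close>

text \<open>
  Both sides count the ways to choose from \<open>m\<close> objects a \<open>k\<close>-set and an \<open>i\<close>-set that meet in
  \<open>l\<close> elements: on the left the \<open>k\<close>-set is chosen first, on the right the \<open>i\<close>-set.
\<close>

lemma choose_split_sample: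
  assumes "l \<le> i" "i \<le> m" "l \<le> k" "k - l \<le> m - i"
  shows "(m choose k) * (k choose l) * ((m - k) choose (i - l))
       = (i choose l) * ((m - i) choose (k - l)) * (m choose i)"
proof -
  have km: "k \<le> m" and "i - l \<le> m - k" using assms by linarith+
  have e: "m - k - (i - l) = m - i - (k - l)" using assms by linarith
  have "real ((m choose k) * (k choose l) * ((m - k) choose (i - l)))
      = real ((i choose l) * ((m - i) choose (k - l)) * (m choose i))"
    using assms km \<open>i - l \<le> m - k\<close> e by (simp add: binomial_fact divide_simps mult_ac)
  then show ?thesis by (simp only: of_nat_eq_iff)
qed

text \<open>
  The power \<open>(x + (1 - x)) ^ (m - k) = 1\<close> lifts the degree from \<open>k\<close> to \<open>m\<close>. Keeping the factor
  \<open>m choose k\<close> on the left makes the coefficients on the right products of one binomial in \<open>l\<close>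
  and one in \<open>k - l\<close>, which is what lets later sums over \<open>k\<close> and \<open>l\<close> factor; it also makes
  the identity hold for \<open>k > m\<close>, where every term vanishes.
\<close>

lemma Bernstein_degree_elevation:
  assumes "l \<le> k"
  shows "real (m choose k) * Bernstein k l x
       = (\<Sum>i\<le>m. real ((i choose l) * ((m - i) choose (k - l))) * Bernstein m i x)"
proof (cases "k \<le> m")
  case False
  have "i < l \<or> m - i < k - l" if "i \<le> m" for i using that False assms by linarith
  then have "real ((i choose l) * ((m - i) choose (k - l))) * Bernstein m i x = 0" if "i \<le> m" for i
    using that by auto
  then show ?thesis using False by (simp add: sum.neutral)
next
  case True
  have "real (m choose k) * Bernstein k l x
      = real (m choose k) * Bernstein k l x * (x + (1 - x)) ^ (m - k)" by simp
  also have "\<dots> = (\<Sum>r\<le>m - k. real ((m choose k) * (k choose l) * ((m - k) choose r))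
        * x ^ (l + r) * (1 - x) ^ (m - (l + r)))"
    unfolding binomial_ring sum_distrib_left
  proof (rule sum.cong)
    fix r assume "r \<in> {..m - k}"
    then have "m - (l + r) = (k - l) + (m - k - r)" using assms True by auto
    then show "real (m choose k) * Bernstein k l x
          * (of_nat (m - k choose r) * x ^ r * (1 - x) ^ (m - k - r))
        = real ((m choose k) * (k choose l) * ((m - k) choose r))
          * x ^ (l + r) * (1 - x) ^ (m - (l + r))"
      by (simp add: Bernstein_def power_add)
  qed simp
  also have "\<dots> = (\<Sum>i\<in>{l..l + (m - k)}. real ((m choose k) * (k choose l) * ((m - k) choose (i - l)))
        * x ^ i * (1 - x) ^ (m - i))"
    by (rule sum.reindex_bij_witness[where i = "\<lambda>i. i - l" and j = "\<lambda>r. l + r"]) auto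
  also have "\<dots> = (\<Sum>i\<le>m. real ((i choose l) * ((m - i) choose (k - l))) * Bernstein m i x)"
  proof (rule sum.mono_neutral_cong_left)
    show "\<forall>i\<in>{..m} - {l..l + (m - k)}.
        real ((i choose l) * ((m - i) choose (k - l))) * Bernstein m i x = 0"
    proof
      fix i assume "i \<in> {..m} - {l..l + (m - k)}"
      then have "i < l \<or> m - i < k - l" using True assms by auto
      then show "real ((i choose l) * ((m - i) choose (k - l))) * Bernstein m i x = 0" by auto
    qed
    fix i assume "i \<in> {l..l + (m - k)}"
    then have "l \<le> i" "i \<le> m" "k - l \<le> m - i" using True assms by auto
    from choose_split_sample[OF this(1,2) assms this(3)]
    show "real ((m choose k) * (k choose l) * ((m - k) choose (i - l))) * x ^ i * (1 - x) ^ (m - i)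
        = real ((i choose l) * ((m - i) choose (k - l))) * Bernstein m i x"
      by (simp only: Bernstein_def of_nat_mult mult.assoc)
  qed (use assms True in auto)
  finally show ?thesis .
qed

section \<open>Integrals of products of Bernstein polynomials\<close>

lemma has_integral_Beta_nat:
  "((\<lambda>t::real. t ^ a * (1 - t) ^ b) has_integral fact a * fact b / fact (a + b + 1)) {0..1}"
proof -
  have "((\<lambda>t. t powr (real (Suc a) - 1) * (1 - t) powr (real (Suc b) - 1))
        has_integral Beta (real (Suc a)) (real (Suc b))) {0..1}"
    by (rule has_integral_Beta_real) auto
  moreover have "Beta (real (Suc a)) (real (Suc b)) = fact a * fact b / fact (a + b + 1)"
    using Gamma_fact[of a, where 'a = real] Gamma_fact[of b, where 'a = real]
      Gamma_fact[of "a + b + 1", where 'a = real]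
    by (simp add: Beta_def add_ac)
  ultimately have "((\<lambda>t. t powr real a * (1 - t) powr real b)
        has_integral fact a * fact b / fact (a + b + 1)) {0..1}" by simp
  \<comment> \<open>The two powers differ at the end points: \<open>0 powr 0 = 0\<close> but \<open>0 ^ 0 = 1\<close>.\<close>
  then show ?thesis
    by (rule has_integral_spike_finite[of "{0, 1}", rotated 2]) (auto simp: powr_realpow)
qed

text \<open>
  The factorials in the Beta integral are distributed so that the dependence on \<open>i\<close> and \<open>j\<close> sits
  in the two binomials that arise as Vandermonde sums in \<open>sum_choose_convolution\<close>.
\<close>

lemma integral_Bernstein_mult:
  assumes "i \<le> m" "j \<le> n"
  shows "(LINT t:{0..1}|lebesgue. Bernstein m i t * Bernstein n j t)
       = fact m * fact n / fact (m + n + 1)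
         * real (((i + j) choose i) * ((m - i + (n - j)) choose (m - i)))"
proof -
  have e: "Bernstein m i t * Bernstein n j t = (real (m choose i) * real (n choose j))
      * (t ^ (i + j) * (1 - t) ^ (m - i + (n - j)))" for t
    by (simp add: Bernstein_def power_add)
  have "i + j + (m - i + (n - j)) + 1 = m + n + 1" using assms by simp
  with has_integral_Beta_nat[of "i + j" "m - i + (n - j)"]
  have "((\<lambda>t::real. t ^ (i + j) * (1 - t) ^ (m - i + (n - j)))
      has_integral fact (i + j) * fact (m - i + (n - j)) / fact (m + n + 1)) {0..1}" by simp
  from has_integral_mult_right[OF this, of "real (m choose i) * real (n choose j)"]
  have "((\<lambda>t. Bernstein m i t * Bernstein n j t) has_integral
      (real (m choose i) * real (n choose j)) *
        (fact (i + j) * fact (m - i + (n - j)) / fact (m + n + 1))) {0..1}"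
    unfolding e .
  moreover have "set_integrable lebesgue {0..1} (\<lambda>t. Bernstein m i t * Bernstein n j t)"
    by (intro set_integrable_continuous continuous_intros)
  ultimately have "(LINT t:{0..1}|lebesgue. Bernstein m i t * Bernstein n j t)
      = (real (m choose i) * real (n choose j)) *
        (fact (i + j) * fact (m - i + (n - j)) / fact (m + n + 1))"
    by (simp add: set_lebesgue_integral_eq_integral integral_unique)
  also have "\<dots> = fact m * fact n / fact (m + n + 1)
         * real (((i + j) choose i) * ((m - i + (n - j)) choose (m - i)))"
    using assms by (simp add: binomial_fact mult_ac del: fact_Suc)
  finally show ?thesis .
qed

section \<open>Composition of diagonal Bernstein kernels\<close>

definition bernstein_kernel :: "nat \<Rightarrow> real \<Rightarrow> real \<Rightarrow> real" where
  "bernstein_kernel k x y = (\<Sum>l\<le>k. Bernstein k l x * Bernstein k l y)"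

lemma sum_choose_mult_choose: "(\<Sum>l\<le>i. (i choose l) * (j choose l)) = (i + j) choose i"
proof -
  have "(\<Sum>l\<le>i. (i choose l) * (j choose l)) = (\<Sum>l\<le>i. (j choose l) * (i choose (i - l)))"
    by (intro sum.cong refl) (metis atMost_iff binomial_symmetric mult.commute)
  then show ?thesis by (simp add: vandermonde add.commute)
qed

text \<open>
  With \<open>s = k - l\<close> the summand separates into a factor in \<open>l\<close> and a factor in \<open>s\<close>. The factors
  vanish unless \<open>l \<le> i\<close> and \<open>s \<le> m - i\<close>, and this rectangle lies inside the triangle
  \<open>l + s \<le> m\<close>, so the sum over the triangle is a product of two sums.
\<close>

lemma sum_choose_convolution:
  assumes "i \<le> m"
  shows "(\<Sum>k\<le>m. \<Sum>l\<le>k. ((i choose l) * ((m - i) choose (k - l)))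
            * ((j choose l) * (r choose (k - l))))
       = ((i + j) choose i) * ((m - i + r) choose (m - i))"
proof -
  let ?g = "\<lambda>l s. ((i choose l) * (j choose l)) * (((m - i) choose s) * (r choose s))"
  have "(\<Sum>k\<le>m. \<Sum>l\<le>k. ((i choose l) * ((m - i) choose (k - l)))
            * ((j choose l) * (r choose (k - l)))) = (\<Sum>k\<le>m. \<Sum>l\<le>k. ?g l (k - l))"
    by (simp add: mult_ac)
  also have "\<dots> = (\<Sum>(l, s)\<in>{(l, s). l + s \<le> m}. ?g l s)"
    by (rule sum.triangle_reindex_eq[symmetric])
  also have "\<dots> = (\<Sum>(l, s)\<in>{..i} \<times> {..m - i}. ?g l s)"
  proof (rule sum.mono_neutral_right)
    have "{(l, s). l + s \<le> m} \<subseteq> {..m} \<times> {..m}" by auto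
    then show "finite {(l, s). l + s \<le> m}" by (rule finite_subset) simp
  qed (use assms in \<open>auto simp: not_le\<close>)
  also have "\<dots> = (\<Sum>l\<le>i. (i choose l) * (j choose l)) * (\<Sum>s\<le>m - i. ((m - i) choose s) * (r choose s))"
    by (simp add: sum.cartesian_product sum_product)
  finally show ?thesis by (simp add: sum_choose_mult_choose)
qed

text \<open>
  Both sides are expanded in the products \<open>p\<^sub>m\<^sub>,\<^sub>i(x) p\<^sub>n\<^sub>,\<^sub>j(y)\<close>. The sum may run up to \<open>m\<close>
  alone, because the terms with \<open>k > n\<close> are zero.
\<close>

lemma bernstein_kernel_composition:
  "(LINT t:{0..1}|lebesgue. bernstein_kernel n t y * bernstein_kernel m x t)
   = fact m * fact n / fact (m + n + 1)
     * (\<Sum>k\<le>m. real ((m choose k) * (n choose k)) * bernstein_kernel k x y)"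
proof -
  let ?c = "\<lambda>m i k l. real ((i choose l) * ((m - i) choose (k - l)))"
  let ?B = "\<lambda>i j. Bernstein m i x * Bernstein n j y"
  let ?w = "\<lambda>i j. real (((i + j) choose i) * ((m - i + (n - j)) choose (m - i)))"
  have "(LINT t:{0..1}|lebesgue. bernstein_kernel n t y * bernstein_kernel m x t)
      = (LINT t:{0..1}|lebesgue. \<Sum>i\<le>m. \<Sum>j\<le>n. ?B i j * (Bernstein m i t * Bernstein n j t))"
    by (subst mult.commute) (simp add: bernstein_kernel_def sum_product mult_ac)
  also have "\<dots> = (\<Sum>i\<le>m. \<Sum>j\<le>n. LINT t:{0..1}|lebesgue.
      ?B i j * (Bernstein m i t * Bernstein n j t))"
    by (subst set_lebesgue_integral_sum set_lebesgue_integral_sum[of "{..n}"],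
        intro set_integrable_continuous continuous_intros)+ (rule refl)
  also have "\<dots> = (\<Sum>i\<le>m. \<Sum>j\<le>n. ?B i j * (fact m * fact n / fact (m + n + 1) * ?w i j))"
    by (intro sum.cong refl) (simp add: integral_Bernstein_mult)
  also have "\<dots> = fact m * fact n / fact (m + n + 1) * (\<Sum>i\<le>m. \<Sum>j\<le>n. ?B i j * ?w i j)"
    by (simp add: sum_distrib_left mult_ac)
  also have "(\<Sum>i\<le>m. \<Sum>j\<le>n. ?B i j * ?w i j)
      = (\<Sum>i\<le>m. \<Sum>j\<le>n. ?B i j * (\<Sum>k\<le>m. \<Sum>l\<le>k. ?c m i k l * ?c n j k l))"
  proof (intro sum.cong refl)
    fix i j assume "i \<in> {..m}"
    then have "(\<Sum>k\<le>m. \<Sum>l\<le>k. ((i choose l) * ((m - i) choose (k - l)))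
            * ((j choose l) * ((n - j) choose (k - l))))
       = ((i + j) choose i) * ((m - i + (n - j)) choose (m - i))"
      by (intro sum_choose_convolution) simp
    from arg_cong[OF this, of real]
    show "?B i j * ?w i j = ?B i j * (\<Sum>k\<le>m. \<Sum>l\<le>k. ?c m i k l * ?c n j k l)"
      by (simp only: of_nat_sum of_nat_mult)
  qed
  also have "\<dots> = (\<Sum>i\<le>m. \<Sum>j\<le>n. \<Sum>k\<le>m. \<Sum>l\<le>k.
      (?c m i k l * Bernstein m i x) * (?c n j k l * Bernstein n j y))"
    by (simp add: sum_distrib_left mult_ac)
  also have "\<dots> = (\<Sum>i\<le>m. \<Sum>k\<le>m. \<Sum>j\<le>n. \<Sum>l\<le>k.
      (?c m i k l * Bernstein m i x) * (?c n j k l * Bernstein n j y))"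
    by (intro sum.cong refl sum.swap)
  also have "\<dots> = (\<Sum>k\<le>m. \<Sum>i\<le>m. \<Sum>j\<le>n. \<Sum>l\<le>k.
      (?c m i k l * Bernstein m i x) * (?c n j k l * Bernstein n j y))"
    by (rule sum.swap)
  also have "\<dots> = (\<Sum>k\<le>m. \<Sum>i\<le>m. \<Sum>l\<le>k. \<Sum>j\<le>n.
      (?c m i k l * Bernstein m i x) * (?c n j k l * Bernstein n j y))"
    by (intro sum.cong refl sum.swap)
  also have "\<dots> = (\<Sum>k\<le>m. \<Sum>l\<le>k. \<Sum>i\<le>m. \<Sum>j\<le>n.
      (?c m i k l * Bernstein m i x) * (?c n j k l * Bernstein n j y))"
    by (intro sum.cong refl sum.swap)
  also have "\<dots> = (\<Sum>k\<le>m. \<Sum>l\<le>k. (real (m choose k) * Bernstein k l x)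
      * (real (n choose k) * Bernstein k l y))"
    by (intro sum.cong refl) (simp only: Bernstein_degree_elevation atMost_iff sum_product)
  also have "\<dots> = (\<Sum>k\<le>m. real ((m choose k) * (n choose k)) * bernstein_kernel k x y)"
    by (simp add: bernstein_kernel_def sum_distrib_left mult_ac)
  finally show ?thesis .
qed

section \<open>Compositions of Durrmeyer kernels\<close>

text \<open>
  This is the coefficient that arises when the composition rule is applied twice: \<open>k\<close> is the
  degree of the diagonal kernel in the two-fold composition, \<open>j\<close> the degree in the three-fold one.
  Absorbing the factorials gives
  \<open>(b choose k) k! / (c + k + 1)! = b! / (c + b + 1)! * (c + b + 1 choose b - k)\<close>, and
  \<open>(a choose k) (k choose j) = (a choose j) (a - j choose k - j)\<close>, so that the sum over \<open>k\<close> is a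
  Vandermonde convolution. If \<open>j\<close> exceeds \<open>a\<close> or \<open>b\<close>, both sides are \<open>0\<close>.
\<close>

lemma sum_choose_choose_fact:
  fixes a b c j :: nat
  shows "(\<Sum>k\<le>b. real ((b choose k) * (a choose k) * (k choose j)) * fact k / fact (c + k + 1))
    = fact (c + b + a + 1) / (fact (c + b + 1) * fact (c + a + 1))
      * (real ((b choose j) * (a choose j)) / real ((c + b + a + 1) choose j))"
proof (cases "j \<le> a \<and> j \<le> b")
  case False
  have "(b choose k) * (a choose k) * (k choose j) = 0" if "k \<le> b" for k
    using that False by (cases "k < j"; cases "a < k") auto
  then have "(\<Sum>k\<le>b. real ((b choose k) * (a choose k) * (k choose j)) * fact k / fact (c + k + 1)) = (0::real)"
    by (intro sum.neutral) (simp del: of_nat_mult mult_eq_0_iff)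
  moreover have "(b choose j) * (a choose j) = 0" using False by auto
  ultimately show ?thesis by (simp del: of_nat_mult)
next
  case True
  let ?N = "c + b + a + 1"
  have term_eq: "real ((b choose k) * (a choose k) * (k choose j)) * fact k / fact (c + k + 1)
      = fact b / fact (c + b + 1) * real (a choose j)
        * real (((a - j) choose (k - j)) * ((c + b + 1) choose (b - k)))"
    if "j \<le> k" "k \<le> b" for k
  proof -
    have 1: "(a choose k) * (k choose j) = (a choose j) * ((a - j) choose (k - j))"
    proof (cases "k \<le> a")
      case le: True
      then show ?thesis using that by (intro choose_mult) auto
    next
      case False
      then have "a - j < k - j" using True by linarith
      then show ?thesis using False by (simp only: binomial_eq_0 not_le mult_0 mult_0_right)
    qed
    have "c + b + 1 - (b - k) = c + k + 1" using that by simp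
    then have 2: "real (b choose k) * fact k / fact (c + k + 1)
        = fact b / fact (c + b + 1) * real ((c + b + 1) choose (b - k))"
      using that by (simp add: binomial_fact[of "b - k"] binomial_fact[of k b])
    have "real ((b choose k) * (a choose k) * (k choose j)) * fact k / fact (c + k + 1)
        = (real (b choose k) * fact k / fact (c + k + 1)) * real ((a choose k) * (k choose j))"
      by (simp add: mult_ac)
    then show ?thesis unfolding 1 2 by (simp add: mult_ac)
  qed
  have "(\<Sum>k\<le>b. real ((b choose k) * (a choose k) * (k choose j)) * fact k / fact (c + k + 1))
      = (\<Sum>k\<in>{j..b}. fact b / fact (c + b + 1) * real (a choose j)
        * real (((a - j) choose (k - j)) * ((c + b + 1) choose (b - k))))"
  proof (rule sum.mono_neutral_cong_right)
    fix k assume "k \<in> {j..b}"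
    then show "real ((b choose k) * (a choose k) * (k choose j)) * fact k / fact (c + k + 1)
      = fact b / fact (c + b + 1) * real (a choose j)
        * real (((a - j) choose (k - j)) * ((c + b + 1) choose (b - k)))"
      by (intro term_eq) auto
  qed auto
  also have "\<dots> = fact b / fact (c + b + 1) * real (a choose j)
      * real (\<Sum>k\<in>{j..b}. ((a - j) choose (k - j)) * ((c + b + 1) choose (b - k)))"
    by (simp only: of_nat_sum sum_distrib_left)
  also have "(\<Sum>k\<in>{j..b}. ((a - j) choose (k - j)) * ((c + b + 1) choose (b - k)))
      = (\<Sum>r\<le>b - j. ((a - j) choose r) * ((c + b + 1) choose (b - j - r)))"
    by (rule sum.reindex_bij_witness[where i = "\<lambda>r. j + r" and j = "\<lambda>k. k - j"]) (use True in auto)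
  also have "\<dots> = (?N - j) choose (b - j)"
  proof -
    have "(a - j) + (c + b + 1) = ?N - j" using True by linarith
    then show ?thesis by (simp only: vandermonde)
  qed
  also have "fact b / fact (c + b + 1) * real (a choose j) * real ((?N - j) choose (b - j))
      = fact ?N / (fact (c + b + 1) * fact (c + a + 1))
      * (real ((b choose j) * (a choose j)) / real (?N choose j))"
  proof -
    have "?N - j - (b - j) = c + a + 1" using True by simp
    then have "real ((?N - j) choose (b - j)) = fact (?N - j) / (fact (b - j) * fact (c + a + 1))"
      using True by (subst binomial_fact) auto
    moreover have "real (b choose j) = fact b / (fact j * fact (b - j))"
      using True by (simp add: binomial_fact)
    moreover have "real (?N choose j) = fact ?N / (fact j * fact (?N - j))"
      using True by (subst binomial_fact) auto
    ultimately show ?thesis by (simp only: of_nat_mult) (simp add: field_simps del: fact_Suc)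
  qed
  finally show ?thesis .
qed

lemma durrmeyer_kernel_eq: "durrmeyer_kernel n x y = (real n + 1) * bernstein_kernel n x y"
  by (simp add: durrmeyer_kernel_def bernstein_kernel_def)

lemma durrmeyer_kernel2_eq:
  "durrmeyer_kernel2 n2 n1 x y = fact (n2 + 1) * fact (n1 + 1) / fact (n2 + n1 + 1)
     * (\<Sum>k\<le>n2. real ((n2 choose k) * (n1 choose k)) * bernstein_kernel k x y)"
proof -
  have "durrmeyer_kernel2 n2 n1 x y = (LINT t:{0..1}|lebesgue. ((real n1 + 1) * (real n2 + 1))
      * (bernstein_kernel n1 t y * bernstein_kernel n2 x t))"
    unfolding durrmeyer_kernel2_def durrmeyer_kernel_eq by (simp add: mult_ac)
  also have "\<dots> = ((real n1 + 1) * (real n2 + 1)) * (fact n2 * fact n1 / fact (n2 + n1 + 1)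
     * (\<Sum>k\<le>n2. real ((n2 choose k) * (n1 choose k)) * bernstein_kernel k x y))"
    by (simp only: set_integral_mult_right bernstein_kernel_composition)
  finally show ?thesis by (simp add: mult_ac add_ac)
qed

theorem theorem3:
  fixes n1 n2 n3 :: nat and x y :: real
  assumes "x \<in> {0..1}" and "y \<in> {0..1}"
  shows "durrmeyer_kernel3 n3 n2 n1 x y =
    (fact (n3 + 1) * fact (n2 + 1) * fact (n1 + 1) * fact (n3 + n2 + n1 + 1))
      / (fact (n3 + n2 + 1) * fact (n3 + n1 + 1) * fact (n2 + n1 + 1))
    * (\<Sum>k = 0..Min {n1, n2, n3}.
        (real (n3 choose k) * real (n2 choose k) * real (n1 choose k))
          / real ((n3 + n2 + n1 + 1) choose k)
        * (\<Sum>l = 0..k. Bernstein k l x * Bernstein k l y))"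
proof -
  let ?N = "n3 + n2 + n1 + 1"
  let ?S = "\<lambda>k. bernstein_kernel k x y"
  let ?C = "fact (n2 + 1) * fact (n1 + 1) / fact (n2 + n1 + 1) * (real n3 + 1) :: real"
  let ?F = "fact ?N / (fact (n3 + n2 + 1) * fact (n3 + n1 + 1)) :: real"
  let ?d = "\<lambda>k. real ((n2 choose k) * (n1 choose k))"
  have "durrmeyer_kernel3 n3 n2 n1 x y = (LINT t:{0..1}|lebesgue. \<Sum>k\<le>n2.
      (?C * ?d k) * (bernstein_kernel k t y * bernstein_kernel n3 x t))"
    unfolding durrmeyer_kernel3_def durrmeyer_kernel2_eq durrmeyer_kernel_eq
    by (simp only: sum_distrib_left sum_distrib_right mult_ac)
  also have "\<dots> = (\<Sum>k\<le>n2. LINT t:{0..1}|lebesgue.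
      (?C * ?d k) * (bernstein_kernel k t y * bernstein_kernel n3 x t))"
    unfolding bernstein_kernel_def
    by (intro set_lebesgue_integral_sum set_integrable_continuous continuous_intros)
  also have "\<dots> = (\<Sum>k\<le>n2. (?C * ?d k) * (fact n3 * fact k / fact (n3 + k + 1)
      * (\<Sum>j\<le>n3. real ((n3 choose j) * (k choose j)) * ?S j)))"
    by (simp only: set_integral_mult_right bernstein_kernel_composition)
  also have "\<dots> = (\<Sum>k\<le>n2. \<Sum>j\<le>n3. ?C * fact n3 * real (n3 choose j) * ?S j
      * (real ((n2 choose k) * (n1 choose k) * (k choose j)) * fact k / fact (n3 + k + 1)))"
    by (simp add: sum_distrib_left mult_ac del: fact_Suc)
  also have "\<dots> = (\<Sum>j\<le>n3. ?C * fact n3 * real (n3 choose j) * ?S j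
      * (\<Sum>k\<le>n2. real ((n2 choose k) * (n1 choose k) * (k choose j)) * fact k / fact (n3 + k + 1)))"
    unfolding sum_distrib_left by (rule sum.swap)
  also have "\<dots> = (\<Sum>j\<le>n3. ?C * fact n3 * real (n3 choose j) * ?S j
      * (?F * (real ((n2 choose j) * (n1 choose j)) / real (?N choose j))))"
    by (simp only: sum_choose_choose_fact)
  also have "\<dots> = (?C * fact n3 * ?F) * (\<Sum>j\<le>n3.
      (real (n3 choose j) * real (n2 choose j) * real (n1 choose j)) / real (?N choose j) * ?S j)"
    unfolding sum_distrib_left by (intro sum.cong refl) (simp add: mult_ac del: fact_Suc)
  also have "(\<Sum>j\<le>n3.
      (real (n3 choose j) * real (n2 choose j) * real (n1 choose j)) / real (?N choose j) * ?S j)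
    = (\<Sum>j = 0..Min {n1, n2, n3}.
      (real (n3 choose j) * real (n2 choose j) * real (n1 choose j)) / real (?N choose j) * ?S j)"
    by (rule sum.mono_neutral_right) (auto simp: not_le min_less_iff_disj)
  also have "?C * fact n3 * ?F
    = (fact (n3 + 1) * fact (n2 + 1) * fact (n1 + 1) * fact ?N)
      / (fact (n3 + n2 + 1) * fact (n3 + n1 + 1) * fact (n2 + n1 + 1))"
  proof -
    have "fact (n3 + 1) = (real n3 + 1) * fact n3" by (simp add: add.commute)
    then show ?thesis by (simp only:) (simp add: mult_ac del: fact_Suc)
  qed
  finally show ?thesis by (simp only: bernstein_kernel_def atMost_atLeast0)
qed

end
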